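(* Let $n$ be a nonnegative integer and let $z$ be a complex number such that all the harmonic numbers appearing below (namely $H_{z-k}$ for $0\le k\le n+1$) are defined. Then $$\sum_{k=0}^n \binom{z}{k} \frac{(-1)^k}{k+1} H_{z-k} = \frac{H_z}{1+z} + \frac{1}{(1+z)^2} + \frac{(-1)^n}{1+z} \binom{z}{n+1} \left ( H_{z-n-1} + \frac{1}{1+z} \right ).$$
   Context: For a complex number $w$ that is not a negative integer, the harmonic number is $H_w=\psi(w+1)+\gamma$, where $\psi=\Gamma'/\Gamma$ is the digamma function and $\gamma$ is the Euler–Mascheroni constant; $H_w$ is undefined when $w$ is a negative integer. It satisfies $H_0=0$ and $H_w=H_{w-1}+\frac1w$ for $w$ not a nonpositive integer, and $H_m=\sum_{k=1}^m \frac1k$ for a positive integer $m$. For complex $z$ and an integer $k\ge0$, $\binom{z}{k}=\frac{z(z-1)\cdots(z-k+1)}{k!}$. *)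

theory Defs
  imports "HOL-Analysis.Analysis"
begin

(* Digamma takes a junk value at its poles (the nonpositive integers), so harmonic_number w
   is meaningful only under harmonic_defined w. *)
definition harmonic_number :: "complex \<Rightarrow> complex" where
  "harmonic_number w = Digamma (w + 1) + euler_mascheroni"

definition harmonic_defined :: "complex \<Rightarrow> bool" where
  "harmonic_defined w \<longleftrightarrow> \<not> (\<exists>m::int. m < 0 \<and> w = of_int m)"

(* Confirms that the digamma function used here is Gamma'/Gamma, on the whole domain of H. *)

lemma harmonic_number_eq_deriv_Gamma:
  assumes "harmonic_defined w"
  shows "harmonic_number w = deriv Gamma (w + 1) / Gamma (w + 1) + euler_mascheroni"
proof -
  have "w + 1 \<notin> \<int>\<^sub>\<le>\<^sub>0"
  proof
    assume "w + 1 \<in> \<int>\<^sub>\<le>\<^sub>0"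
    then obtain k :: int where "k \<le> 0" "w + 1 = of_int k"
      by (auto elim!: nonpos_Ints_cases)
    hence "k - 1 < 0" "w = of_int (k - 1)" by (simp_all add: algebra_simps)
    thus False using assms unfolding harmonic_defined_def by blast
  qed
  thus ?thesis
    using DERIV_imp_deriv[OF has_field_derivative_Gamma[of "w + 1" UNIV]]
    by (simp add: harmonic_number_def Gamma_eq_zero_iff)
qed

lemma harmonic_number_of_nat: "harmonic_number (of_nat m) = (\<Sum>k=1..m. 1 / of_nat k)"
  using Digamma_of_nat[of m, where 'a = complex]
  by (simp add: harmonic_number_def harm_def inverse_eq_divide add.commute)

end

theory Submission
  imports Defs
begin

text \<open>
  The sum telescopes. Put
  \[ T_k = \frac{(-1)^k}{1+z} \binom{z}{k} \Bigl(H_{z-k} + \frac{1}{1+z}\Bigr). \]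
  The recurrences \<open>H\<^sub>w = H\<^sub>w\<^sub>-\<^sub>1 + 1/w\<close> at \<open>w = z - k\<close> and
  \<open>(k+1) \<cdot> (z choose k+1) = (z - k) \<cdot> (z choose k)\<close> express \<open>T\<^sub>k\<^sub>+\<^sub>1\<close> through
  \<open>z choose k\<close> and \<open>H\<^sub>z\<^sub>-\<^sub>k\<close>. Take the factor \<open>1/(k+1)\<close> out of
  \<open>T\<^sub>k - T\<^sub>k\<^sub>+\<^sub>1\<close>. Then the coefficient of \<open>H\<^sub>z\<^sub>-\<^sub>k\<close> collects
  \<open>(k + 1) + (z - k) = 1 + z\<close>, which cancels the leading \<open>1/(1+z)\<close>. The part free of \<open>H\<^sub>z\<^sub>-\<^sub>k\<close> is
  proportional to \<open>(1+z) \<cdot> 1/(1+z) - 1\<close>, that is, to \<open>0\<close>: this is why the summand \<open>1/(1+z)\<close>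
  accompanies the harmonic number in \<open>T\<^sub>k\<close>. What remains is the \<open>k\<close>-th summand, and the sum over
  \<open>k \<le> n\<close> is \<open>T\<^sub>0 - T\<^sub>n\<^sub>+\<^sub>1\<close>.
\<close>

text \<open>
  Definedness at \<open>w - 1\<close> is what rules out \<open>w = 0\<close>, where the recurrence breaks down.
\<close>
lemma harmonic_number_rec:
  assumes "harmonic_defined (w - 1)"
  shows "w \<noteq> 0" "harmonic_number w = harmonic_number (w - 1) + 1 / w"
proof -
  show "w \<noteq> 0"
  proof
    assume "w = 0"
    hence "w - 1 = of_int (-1)" by simp
    thus False using assms unfolding harmonic_defined_def by (metis neg_less_0_iff_less zero_less_one)
  qed
  thus "harmonic_number w = harmonic_number (w - 1) + 1 / w"
    by (simp add: harmonic_number_def Digamma_plus1)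
qed

lemma gbinomial_Suc_eq_mult_divide:
  fixes z :: "'a::field_char_0"
  shows "(z gchoose Suc k) = (z gchoose k) * (z - of_nat k) / of_nat (Suc k)"
  using gbinomial_mult_1[of z k] by (simp add: field_simps del: of_nat_Suc)

definition harmonic_telescope :: "complex \<Rightarrow> nat \<Rightarrow> complex" where
  "harmonic_telescope z k =
     (-1) ^ k / (1 + z) * (z gchoose k) * (harmonic_number (z - of_nat k) + 1 / (1 + z))"

lemma harmonic_telescope_diff:
  assumes "1 + z \<noteq> 0" and "harmonic_defined (z - of_nat (Suc k))"
  shows "harmonic_telescope z k - harmonic_telescope z (Suc k) =
           (z gchoose k) * ((-1) ^ k / of_nat (k + 1)) * harmonic_number (z - of_nat k)"
proof -
  define s where "s = (-1 :: complex) ^ k"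
  define B where "B = (z gchoose k)"
  define H where "H = harmonic_number (z - of_nat k)"
  define d where "d = z - of_nat k"
  define m :: complex where "m = of_nat (Suc k)"
  have m: "m \<noteq> 0" unfolding m_def by (rule of_nat_neq_0)
  have shift: "z - of_nat (Suc k) = z - of_nat k - 1" by simp
  have d: "d \<noteq> 0" and H': "harmonic_number (z - of_nat (Suc k)) = H - 1 / d"
    using harmonic_number_rec[of "z - of_nat k"] assms(2) unfolding shift H_def d_def by auto
  have "harmonic_telescope z k - harmonic_telescope z (Suc k) =
          s / (1 + z) * B * (H + 1 / (1 + z)) + s / (1 + z) * (B * d / m) * (H - 1 / d + 1 / (1 + z))"
    unfolding harmonic_telescope_def H' gbinomial_Suc_eq_mult_divide
    by (simp add: s_def B_def H_def d_def m_def)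
  also have "\<dots> = s * B / ((1 + z) * m) * ((m + d) * (H + 1 / (1 + z)) - 1)"
    using assms(1) m d by (simp add: divide_simps) (simp add: algebra_simps)
  also have "m + d = 1 + z" by (simp add: m_def d_def)
  also have "s * B / ((1 + z) * m) * ((1 + z) * (H + 1 / (1 + z)) - 1) = B * (s / m) * H"
    using assms(1) m by (simp add: distrib_left)
  finally show ?thesis by (simp add: s_def B_def H_def m_def)
qed

theorem proposition4p1:
  fixes n :: nat and z :: complex
  assumes "\<And>k::nat. k \<le> n + 1 \<Longrightarrow> harmonic_defined (z - of_nat k)"
  shows "(\<Sum>k=0..n. (z gchoose k) * ((-1) ^ k / of_nat (k + 1)) * harmonic_number (z - of_nat k))
       = harmonic_number z / (1 + z) + 1 / (1 + z)\<^sup>2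
         + (-1) ^ n / (1 + z) * (z gchoose (n + 1))
           * (harmonic_number (z - of_nat n - 1) + 1 / (1 + z))"
proof -
  \<comment> \<open>\<open>H\<^sub>z\<close> itself is defined, so \<open>z\<close> is not \<open>-1\<close>.\<close>
  have z: "1 + z \<noteq> 0"
    using harmonic_number_rec(1)[of "1 + z"] assms[of 0] by simp
  have "(\<Sum>k=0..n. (z gchoose k) * ((-1) ^ k / of_nat (k + 1)) * harmonic_number (z - of_nat k))
      = (\<Sum>k=0..n. harmonic_telescope z k - harmonic_telescope z (Suc k))"
    by (intro sum.cong refl harmonic_telescope_diff[symmetric] z assms) auto
  also have "\<dots> = harmonic_telescope z 0 - harmonic_telescope z (Suc n)"
    using sum_telescope[of "harmonic_telescope z" n] by (simp add: atLeast0AtMost)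
  also have "harmonic_telescope z 0 = harmonic_number z / (1 + z) + 1 / (1 + z)\<^sup>2"
    by (simp add: harmonic_telescope_def power2_eq_square distrib_left)
  also have "harmonic_telescope z (Suc n) = - ((-1) ^ n / (1 + z) * (z gchoose (n + 1))
           * (harmonic_number (z - of_nat n - 1) + 1 / (1 + z)))"
    by (simp add: harmonic_telescope_def algebra_simps)
  finally show ?thesis by simp
qed

end
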